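(* There is no polynomial $\mathbf{ResSV}$ proof $\mathit{PHP}\vdash_{\mathbf{ResSV}}\{(\Box,\infty)\}$; that is, there is no family of $\mathbf{ResSV}$ proofs of $\{(\Box,\infty)\}$ from $\mathit{PHP}_m$ whose lengths are bounded by a polynomial in $m$.
   Context: A literal is a Boolean variable $x$ or its negation $\overline x$; a clause is a disjunction of literals ($\Box$ is the empty clause). Weights are elements of $\mathbb{R}_{>0}\cup\{\infty\}$ with $\infty+w=\infty-w=\infty$; during $\mathbf{ResSV}$ proofs clauses may also carry finite negative weights. A MaxSAT formula is a finite collection of weighted clauses $(C,w)$, where $(C,u),(C,v)$ may be merged into $(C,u+v)$ and conversely, and clauses of weight $0$ disappear. $\mathcal G\subseteq\mathcal F$ means every $(C,w)\in\mathcal G$ has some $(C,w')\in\mathcal F$ with $w\le w'$. A MaxSAT inference rule replaces its antecedents in the current formula by its consequents. A proof is a sequence $\mathcal F_0;\dots;\mathcal F_e$ (length $e$), each obtained from the previous by one rule application; $\mathcal F\vdash_{\mathbf{ResSV}}\mathcal G$ means there is such a proof with $\mathcal F_0=\mathcal F$, $\mathcal G\subseteq\mathcal F_e$ and all clauses of $\mathcal F_e$ having positive weight. $\mathbf{ResSV}$ rules: Resolution: from $(x\lor A,v),(\overline x\lor B,w)$ with $v,w$ positive ($A,B$ possibly empty), with $m=\min\{v,w\}$, derive $(A\lor B,m),(x\lor A,v-m),(\overline x\lor B,w-m),(x\lor A\lor\overline B,m),(\overline x\lor B\lor\overline A,m)$, where for $D=l_1\lor\dots\lor l_p$ the expression $(E\lor\overline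 D,u)$ stands for $(E\lor\overline{l_1},u),(E\lor l_1\lor\overline{l_2},u),\dots,(E\lor l_1\lor\dots\lor l_{p-1}\lor\overline{l_p},u)$ (nothing if $D$ is empty), and tautologies are discarded. Split: from $(A,w)$ with $w$ positive derive $(A\lor x,w),(A\lor\overline x,w)$. Virtual: with no antecedents, introduce $(A,w),(A,-w)$ for any clause $A$ and finite $w$. Pigeon hole problem: for $m\ge1$ take variables $x_{ij}$, $1\le i\le m+1$, $1\le j\le m$; let $\mathcal K_m$ consist of the clauses $x_{i1}\lor\dots\lor x_{im}$ for each $i$ and $\overline x_{ij}\lor\overline x_{i'j}$ for each $j$ and $1\le i<i'\le m+1$. $\mathit{PHP}_m=\{(C,\infty)\mid C\in\mathcal K_m\}$. *)

theory Defs
  imports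
    "HOL-Library.Multiset"
    "HOL-Library.FSet"
    "HOL-Library.Extended_Real"
    "HOL-Computational_Algebra.Polynomial"
begin

datatype 'v literal = Pos 'v | Neg 'v

primrec lit_neg :: "'v literal \<Rightarrow> 'v literal" where
  "lit_neg (Pos x) = Neg x"
| "lit_neg (Neg x) = Pos x"

type_synonym 'v clause = "'v literal fset"

definition tautology :: "'v clause \<Rightarrow> bool" where
  "tautology C \<longleftrightarrow> (\<exists>x. Pos x |\<in>| C \<and> Neg x |\<in>| C)"

text \<open>
  Weights are extended reals other than \<open>- \<infinity>\<close>. On \<^typ>\<open>ereal\<close> one has
  \<open>\<infinity> + w = \<infinity> - w = \<infinity>\<close> for every such \<open>w\<close>, including \<open>\<infinity> - \<infinity> = \<infinity>\<close>.
\<close>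

type_synonym 'v formula = "('v clause \<times> ereal) multiset"

definition subformula :: "'v formula \<Rightarrow> 'v formula \<Rightarrow> bool" where
  "subformula G F \<longleftrightarrow> (\<forall>(C, w) \<in># G. \<exists>w'. (C, w') \<in># F \<and> w \<le> w')"

inductive regroup :: "'v formula \<Rightarrow> 'v formula \<Rightarrow> bool" where
  merge: "u \<noteq> -\<infinity> \<Longrightarrow> v \<noteq> -\<infinity> \<Longrightarrow>
    regroup (R + {#(C, u), (C, v)#}) (R + {#(C, u + v)#})"
| unmerge: "u \<noteq> -\<infinity> \<Longrightarrow> v \<noteq> -\<infinity> \<Longrightarrow>
    regroup (R + {#(C, u + v)#}) (R + {#(C, u), (C, v)#})"
| drop_zero: "regroup (R + {#(C, 0)#}) R"

text \<open>
  \<open>or_not E [l\<^sub>1, \<dots>, l\<^sub>p]\<close> lists the clauses abbreviated by \<open>E \<or> \<not> (l\<^sub>1 \<or> \<dots> \<or> l\<^sub>p)\<close>,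
  namely \<open>E \<or> l\<^sub>1 \<or> \<dots> \<or> l\<^sub>k\<^sub>-\<^sub>1 \<or> \<not> l\<^sub>k\<close> for \<open>1 \<le> k \<le> p\<close>. They depend on the
  order of the literals, so the side clauses of a resolution step come with an enumeration,
  which is arbitrary.
\<close>

primrec or_not :: "'v clause \<Rightarrow> 'v literal list \<Rightarrow> 'v clause list" where
  "or_not E [] = []"
| "or_not E (l # ls) = finsert (lit_neg l) E # or_not (finsert l E) ls"

definition resolution_consequents ::
  "'v \<Rightarrow> 'v literal list \<Rightarrow> 'v literal list \<Rightarrow> ereal \<Rightarrow> ereal \<Rightarrow> 'v formula" where
  "resolution_consequents x as bs v w =
    (let A = fset_of_list as; B = fset_of_list bs; m = min v w in
      filter_mset (\<lambda>(C, u). \<not> tautology C)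
        ({#(A |\<union>| B, m), (finsert (Pos x) A, v - m), (finsert (Neg x) B, w - m)#}
         + mset (map (\<lambda>C. (C, m)) (or_not (finsert (Pos x) A) bs))
         + mset (map (\<lambda>C. (C, m)) (or_not (finsert (Neg x) B) as))))"

inductive ressv_rule :: "'v formula \<Rightarrow> 'v formula \<Rightarrow> bool" where
  resolution: "v > 0 \<Longrightarrow> w > 0 \<Longrightarrow> distinct as \<Longrightarrow> distinct bs \<Longrightarrow>
    ressv_rule
      (R + {#(finsert (Pos x) (fset_of_list as), v), (finsert (Neg x) (fset_of_list bs), w)#})
      (R + resolution_consequents x as bs v w)"
| split: "w > 0 \<Longrightarrow>
    ressv_rule (R + {#(A, w)#}) (R + {#(finsert (Pos x) A, w), (finsert (Neg x) A, w)#})"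
| virtual: "ressv_rule R (R + {#(A, ereal r), (A, - ereal r)#})"

definition ressv_step :: "'v formula \<Rightarrow> 'v formula \<Rightarrow> bool" where
  "ressv_step F F' \<longleftrightarrow> (\<exists>G G'. regroup\<^sup>*\<^sup>* F G \<and> ressv_rule G G' \<and> regroup\<^sup>*\<^sup>* G' F')"

definition ressv_proof :: "'v formula \<Rightarrow> 'v formula list \<Rightarrow> 'v formula \<Rightarrow> bool" where
  "ressv_proof F Fs G \<longleftrightarrow>
    Fs \<noteq> [] \<and> hd Fs = F \<and>
    (\<forall>i < length Fs - 1. ressv_step (Fs ! i) (Fs ! Suc i)) \<and>
    subformula G (last Fs) \<and> (\<forall>(C, w) \<in># last Fs. w > 0)"

definition proof_length :: "'v formula list \<Rightarrow> nat" where
  "proof_length Fs = length Fs - 1"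

text \<open>The variable \<open>x\<^sub>i\<^sub>j\<close> of the pigeon hole problem is the pair \<open>(i, j)\<close>.\<close>

definition php_clauses :: "nat \<Rightarrow> (nat \<times> nat) clause set" where
  "php_clauses m =
    {fset_of_list (map (\<lambda>j. Pos (i, j)) [1..<m + 1]) | i. i \<in> {1..m + 1}} \<union>
    {{|Neg (i, j), Neg (i', j)|} | i i' j. 1 \<le> i \<and> i < i' \<and> i' \<le> m + 1 \<and> j \<in> {1..m}}"

lemma finite_php_clauses: "finite (php_clauses m)"
proof -
  have "{{|Neg (i, j), Neg (i', j)|} | i i' j. 1 \<le> i \<and> i < i' \<and> i' \<le> m + 1 \<and> j \<in> {1..m}}
      \<subseteq> (\<lambda>(i, i', j). {|Neg (i, j), Neg (i', j)|}) ` ({..m + 1} \<times> {..m + 1} \<times> {..m})"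
    (is "?S \<subseteq> ?f ` ?D")
  proof
    fix C assume "C \<in> ?S"
    then obtain i i' j where "C = ?f (i, i', j)" "(i, i', j) \<in> ?D"
      by auto
    then show "C \<in> ?f ` ?D"
      by (rule image_eqI)
  qed
  then have "finite ?S"
    by (rule finite_subset) simp
  then show ?thesis
    unfolding php_clauses_def by simp
qed

definition PHP :: "nat \<Rightarrow> (nat \<times> nat) formula" where
  "PHP m = image_mset (\<lambda>C. (C, \<infinity>)) (mset_set (php_clauses m))"

end

theory Submission
  imports Defs
begin

text \<open>
  No rule can create an infinite weight except from infinite weights, so the clauses of infinite
  weight form a resolution refutation with weakening, in which each step contributes at most one
  essentially new clause. The exponential lower bound for such refutations follows the argument
  of Beame and Pitassi: some clause of a refutation mentions quadratically many positions
  \<open>(i, j)\<close> once it is rewritten with positive literals only, whereas if there are few clauses,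
  greedily placing a linear number of pigeons satisfies all clauses with that many positions and
  leaves a smaller pigeon hole problem.
\<close>

section \<open>Derivations and their extraction from weighted proofs\<close>

definition satisfies :: "'v set \<Rightarrow> 'v clause \<Rightarrow> bool" where
  "satisfies \<alpha> C \<longleftrightarrow> (\<exists>x. Pos x |\<in>| C \<and> x \<in> \<alpha> \<or> Neg x |\<in>| C \<and> x \<notin> \<alpha>)"

lemma satisfies_mono: "C |\<subseteq>| D \<Longrightarrow> satisfies \<alpha> C \<Longrightarrow> satisfies \<alpha> D"
  unfolding satisfies_def by blast

lemma not_satisfies_empty: "\<not> satisfies \<alpha> {||}"
  unfolding satisfies_def by simp

text \<open>Admitting every semantic consequence of two available clauses treats resolution and
  weakening alike; the lower bound relies only on this soundness. The newest clause stands first in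
  the list.\<close>

inductive derivation :: "'v clause set \<Rightarrow> 'v clause list \<Rightarrow> bool" for K where
  Nil: "derivation K []"
| Cons: "derivation K Cs \<Longrightarrow> C1 \<in> K \<union> set Cs \<Longrightarrow> C2 \<in> K \<union> set Cs \<Longrightarrow>
    (\<And>\<alpha>. satisfies \<alpha> C1 \<Longrightarrow> satisfies \<alpha> C2 \<Longrightarrow> satisfies \<alpha> C) \<Longrightarrow> derivation K (C # Cs)"

text \<open>Subsumption replaces membership so that weakened clauses of infinite weight cost no new
  line.\<close>

definition covers :: "'v clause set \<Rightarrow> 'v formula \<Rightarrow> bool" where
  "covers S F \<longleftrightarrow> (\<forall>C. (C, \<infinity>) \<in># F \<longrightarrow> (\<exists>D\<in>S. D |\<subseteq>| C))"

text \<open>A sum of weights other than \<open>-\<infinity>\<close> is infinite exactly when one of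
  its summands is.\<close>

lemma regroup_infinite:
  assumes "regroup F G" "(C, \<infinity>) \<in># G"
  shows "(C, \<infinity>) \<in># F"
  using assms
proof cases
  case (merge u v R D)
  then show ?thesis using assms(2) by (cases u; cases v) auto
next
  case (unmerge u v R D)
  then show ?thesis using assms(2) by (cases u; cases v) auto
next
  case (drop_zero D)
  then show ?thesis using assms(2) by auto
qed

lemma covers_regroup:
  assumes "regroup\<^sup>*\<^sup>* F G" "covers S F"
  shows "covers S G"
  using assms
  by (induction rule: rtranclp_induct) (auto simp: covers_def dest: regroup_infinite)

lemma or_not_superset: "D \<in> set (or_not E ls) \<Longrightarrow> E |\<subseteq>| D"
proof (induction ls arbitrary: E)
  case (Cons l ls)
  then show ?case by fastforce
qed simp

text \<open>For positive weights, \<open>min v w\<close> is infinite only if both are, and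
  \<open>v - min v w\<close> only if \<open>v\<close> is. Every consequent except the resolvent
  contains an antecedent.\<close>

lemma resolution_consequents_infinite:
  assumes "(C, \<infinity>) \<in># resolution_consequents x as bs v w" "v > 0" "w > 0"
  shows "v = \<infinity> \<and> finsert (Pos x) (fset_of_list as) |\<subseteq>| C \<or>
    w = \<infinity> \<and> finsert (Neg x) (fset_of_list bs) |\<subseteq>| C \<or>
    v = \<infinity> \<and> w = \<infinity> \<and> C = fset_of_list as |\<union>| fset_of_list bs"
proof -
  have min: "min v w = \<infinity> \<Longrightarrow> v = \<infinity> \<and> w = \<infinity>"
    by (simp add: min_def split: if_splits)
  have sub: "v - min v w = \<infinity> \<Longrightarrow> v = \<infinity>" "w - min v w = \<infinity> \<Longrightarrow> w = \<infinity>"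
    using assms(2,3) by (cases v; cases w; auto simp: min_def split: if_splits)+
  from assms(1) consider
      "C = fset_of_list as |\<union>| fset_of_list bs" "min v w = \<infinity>"
    | "C = finsert (Pos x) (fset_of_list as)" "v - min v w = \<infinity>"
    | "C = finsert (Neg x) (fset_of_list bs)" "w - min v w = \<infinity>"
    | "C \<in> set (or_not (finsert (Pos x) (fset_of_list as)) bs)" "min v w = \<infinity>"
    | "C \<in> set (or_not (finsert (Neg x) (fset_of_list bs)) as)" "min v w = \<infinity>"
    unfolding resolution_consequents_def Let_def set_mset_filter
    by (auto simp: eq_commute[of \<infinity>])
  then show ?thesis
  proof cases
    case 4
    then show ?thesis using min or_not_superset by blast
  next
    case 5
    then show ?thesis using min or_not_superset by blast
  qed (use min sub in auto)
qed

text \<open>The covering clauses may be proper subclauses of the antecedents, even without the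
  pivot; the resolvent is still a consequence of them.\<close>

lemma satisfies_resolvent:
  assumes "C1 |\<subseteq>| finsert (Pos x) A" "C2 |\<subseteq>| finsert (Neg x) B"
    and "satisfies \<alpha> C1" "satisfies \<alpha> C2"
  shows "satisfies \<alpha> (A |\<union>| B)"
proof -
  have "satisfies \<alpha> (finsert (Pos x) A)" "satisfies \<alpha> (finsert (Neg x) B)"
    using assms satisfies_mono by blast+
  then show ?thesis unfolding satisfies_def by auto
qed

text \<open>Side clauses and split clauses are weakenings, so only the resolvent of two infinite-weight
  clauses needs a new line.\<close>

lemma ressv_rule_derivation:
  assumes "ressv_rule F G" "derivation K Cs" "covers (K \<union> set Cs) F"
  shows "\<exists>Ds. derivation K Ds \<and> length Ds \<le> Suc (length Cs) \<and> covers (K \<union> set Ds) G"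
  using assms(1)
proof cases
  case (resolution v w as bs R x)
  let ?A = "fset_of_list as" and ?B = "fset_of_list bs"
  note inf = resolution_consequents_infinite[OF _ resolution(3,4)]
  have covR: "\<exists>D\<in>K \<union> set Cs. D |\<subseteq>| C" if "(C, \<infinity>) \<in># R" for C
    using that assms(3) resolution(1) unfolding covers_def by auto
  have covA: "\<exists>D\<in>K \<union> set Cs. D |\<subseteq>| finsert (Pos x) ?A" if "v = \<infinity>"
    using that assms(3) resolution(1) unfolding covers_def by auto
  have covB: "\<exists>D\<in>K \<union> set Cs. D |\<subseteq>| finsert (Neg x) ?B" if "w = \<infinity>"
    using that assms(3) resolution(1) unfolding covers_def by auto
  show ?thesis
  proof (cases "v = \<infinity> \<and> w = \<infinity>")
    case True
    then obtain C1 C2 where C12: "C1 \<in> K \<union> set Cs" "C1 |\<subseteq>| finsert (Pos x) ?A"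
        "C2 \<in> K \<union> set Cs" "C2 |\<subseteq>| finsert (Neg x) ?B"
      using covA covB by blast
    have "derivation K ((?A |\<union>| ?B) # Cs)"
      using assms(2) C12(1,3) by (rule derivation.Cons) (rule satisfies_resolvent[OF C12(2,4)])
    moreover have "covers (K \<union> set ((?A |\<union>| ?B) # Cs)) G"
      unfolding covers_def
    proof (intro allI impI)
      fix C assume "(C, \<infinity>) \<in># G"
      then consider "(C, \<infinity>) \<in># R" | "(C, \<infinity>) \<in># resolution_consequents x as bs v w"
        using resolution(2) by auto
      then show "\<exists>D\<in>K \<union> set ((?A |\<union>| ?B) # Cs). D |\<subseteq>| C"
      proof cases
        case 1
        then show ?thesis using covR by fastforce
      next
        case 2
        from inf[OF this] consider "finsert (Pos x) ?A |\<subseteq>| C" | "finsert (Neg x) ?B |\<subseteq>| C"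
          | "C = ?A |\<union>| ?B" by blast
        then show ?thesis
        proof cases
          case 1 then show ?thesis using C12 by (meson UnCI UnE list.set_intros(2) order_trans)
        next
          case 2 then show ?thesis using C12 by (meson UnCI UnE list.set_intros(2) order_trans)
        next
          case 3 then show ?thesis by auto
        qed
      qed
    qed
    ultimately show ?thesis by (intro exI[of _ "(?A |\<union>| ?B) # Cs"]) simp
  next
    case False
    \<comment> \<open>With one finite weight the resolvent gets finite weight, so the old list still
      suffices.\<close>
    have "covers (K \<union> set Cs) G"
      unfolding covers_def
    proof (intro allI impI)
      fix C assume "(C, \<infinity>) \<in># G"
      then consider "(C, \<infinity>) \<in># R" | "(C, \<infinity>) \<in># resolution_consequents x as bs v w"
        using resolution(2) by auto
      then show "\<exists>D\<in>K \<union> set Cs. D |\<subseteq>| C"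
      proof cases
        case 1
        then show ?thesis using covR by blast
      next
        case 2
        from inf[OF this] False covA covB show ?thesis by (meson order_trans)
      qed
    qed
    then show ?thesis using assms(2) by (intro exI[of _ Cs]) simp
  qed
next
  case (split w R A x)
  have "covers (K \<union> set Cs) G"
    unfolding covers_def
  proof (intro allI impI)
    fix C assume "(C, \<infinity>) \<in># G"
    then obtain D where "(D, \<infinity>) \<in># F" "D |\<subseteq>| C"
      using split by auto
    then show "\<exists>D\<in>K \<union> set Cs. D |\<subseteq>| C"
      using assms(3) unfolding covers_def by (meson order_trans)
  qed
  then show ?thesis using assms(2) by (intro exI[of _ Cs]) simp
next
  case (virtual A r)
  have "covers (K \<union> set Cs) G"
    using virtual assms(3) unfolding covers_def by auto
  then show ?thesis using assms(2) by (intro exI[of _ Cs]) simp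
qed

lemma ressv_step_derivation:
  assumes "ressv_step F G" "derivation K Cs" "covers (K \<union> set Cs) F"
  shows "\<exists>Ds. derivation K Ds \<and> length Ds \<le> Suc (length Cs) \<and> covers (K \<union> set Ds) G"
proof -
  obtain F' G' where *: "regroup\<^sup>*\<^sup>* F F'" "ressv_rule F' G'" "regroup\<^sup>*\<^sup>* G' G"
    using assms(1) unfolding ressv_step_def by blast
  show ?thesis
    using ressv_rule_derivation[OF *(2) assms(2) covers_regroup[OF *(1) assms(3)]]
      covers_regroup[OF *(3)] by blast
qed

lemma ressv_proof_derivation:
  assumes "ressv_proof F Fs {#({||}, \<infinity>)#}" and K: "covers K F"
  obtains Cs where "derivation K Cs" "length Cs \<le> proof_length Fs" "{||} \<in> K \<union> set Cs"
proof -
  have Fs: "Fs \<noteq> []" "Fs ! 0 = F" "\<And>i. i < length Fs - 1 \<Longrightarrow> ressv_step (Fs ! i) (Fs ! Suc i)"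
    and sub: "subformula {#({||}, \<infinity>)#} (last Fs)"
    using assms(1) unfolding ressv_proof_def by (auto simp: hd_conv_nth)
  have "\<exists>Cs. derivation K Cs \<and> length Cs \<le> i \<and> covers (K \<union> set Cs) (Fs ! i)"
    if "i \<le> length Fs - 1" for i
    using that
  proof (induction i)
    case 0
    then show ?case using derivation.Nil[of K] K Fs(2) by (intro exI[of _ "[]"]) simp
  next
    case (Suc i)
    then obtain Cs where "derivation K Cs" "length Cs \<le> i" "covers (K \<union> set Cs) (Fs ! i)"
      by auto
    moreover have "ressv_step (Fs ! i) (Fs ! Suc i)"
      using Fs(3) Suc.prems by simp
    ultimately obtain Ds where "derivation K Ds" "length Ds \<le> Suc (length Cs)"
        "covers (K \<union> set Ds) (Fs ! Suc i)"
      using ressv_step_derivation by blast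
    then show ?case using \<open>length Cs \<le> i\<close> by (intro exI[of _ Ds]) simp
  qed
  from this[of "length Fs - 1"] obtain Cs where Cs: "derivation K Cs"
      "length Cs \<le> proof_length Fs" "covers (K \<union> set Cs) (last Fs)"
    using Fs(1) unfolding proof_length_def by (auto simp: last_conv_nth)
  \<comment> \<open>A weight at least \<open>\<infinity>\<close> is \<open>\<infinity>\<close>, and
    only the empty clause is contained in the empty clause.\<close>
  from sub have "({||}, \<infinity>) \<in># last Fs"
    unfolding subformula_def by auto
  then obtain D where "D \<in> K \<union> set Cs" "D |\<subseteq>| {||}"
    using Cs(3) unfolding covers_def by blast
  then show ?thesis using that Cs by auto
qed

section \<open>Critical assignments and positive forms\<close>

text \<open>A critical assignment is given by the map sending each hole to its pigeon; it leaves out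
  exactly one pigeon.\<close>

definition critical :: "nat \<Rightarrow> (nat \<Rightarrow> nat) \<Rightarrow> bool" where
  "critical m f \<longleftrightarrow> inj_on f {1..m} \<and> f ` {1..m} \<subseteq> {1..m+1}"

definition occupied :: "nat \<Rightarrow> (nat \<Rightarrow> nat) \<Rightarrow> (nat \<times> nat) set" where
  "occupied m f = {(f j, j) | j. j \<in> {1..m}}"

lemma mem_occupied: "(i, j) \<in> occupied m f \<longleftrightarrow> j \<in> {1..m} \<and> f j = i"
  unfolding occupied_def by auto

lemma critical_missing:
  assumes "critical m f" "i \<in> {1..m+1}" "i \<notin> f ` {1..m}"
  shows "f ` {1..m} = {1..m+1} - {i}"
proof (rule card_subset_eq)
  show "f ` {1..m} \<subseteq> {1..m+1} - {i}" using assms unfolding critical_def by auto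
  show "card (f ` {1..m}) = card ({1..m+1} - {i})"
    using assms unfolding critical_def by (simp add: card_image)
qed simp

text \<open>On critical assignments every clause is equivalent to a disjunction of positive literals,
  since \<open>\<not> x\<^sub>i\<^sub>j\<close> says that hole \<open>j\<close> is taken by a pigeon other than \<open>i\<close>.\<close>

definition pos_form :: "nat \<Rightarrow> (nat \<times> nat) clause \<Rightarrow> (nat \<times> nat) set" where
  "pos_form m C = {(i, j). i \<in> {1..m+1} \<and> j \<in> {1..m} \<and>
     (\<forall>f. critical m f \<longrightarrow> f j = i \<longrightarrow> satisfies (occupied m f) C)}"

lemma satisfies_iff_pos_form:
  assumes f: "critical m f" and "m \<ge> 1"
  shows "satisfies (occupied m f) C \<longleftrightarrow> (\<exists>j\<in>{1..m}. (f j, j) \<in> pos_form m C)"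
proof
  have f_in: "f j \<in> {1..m+1}" if "j \<in> {1..m}" for j
    using f that unfolding critical_def by blast
  assume "satisfies (occupied m f) C"
  then consider i j where "Pos (i, j) |\<in>| C" "(i, j) \<in> occupied m f"
    | i j where "Neg (i, j) |\<in>| C" "(i, j) \<notin> occupied m f"
    unfolding satisfies_def by auto
  then show "\<exists>j\<in>{1..m}. (f j, j) \<in> pos_form m C"
  proof cases
    case 1
    then have "j \<in> {1..m}" "f j = i" by (auto simp: mem_occupied)
    moreover have "satisfies (occupied m g) C" if "g j = i" for g
      using 1 that \<open>j \<in> {1..m}\<close> unfolding satisfies_def
      by (intro exI[of _ "(i, j)"]) (simp add: mem_occupied)
    ultimately show ?thesis using f_in[of j] unfolding pos_form_def by (intro bexI[of _ j]) auto
  next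
    case 2
    show ?thesis
    proof (cases "j \<in> {1..m}")
      case True
      \<comment> \<open>The negative literal holds because \<open>f j\<close> sits in hole
        \<open>j\<close>, and it holds for every \<open>g\<close> with the same pigeon
        there.\<close>
      then have "f j \<noteq> i" using 2 by (auto simp: mem_occupied)
      then have "satisfies (occupied m g) C" if "g j = f j" for g
        using 2 that unfolding satisfies_def
        by (intro exI[of _ "(i, j)"]) (simp add: mem_occupied)
      then show ?thesis using f_in[of j] True unfolding pos_form_def by (intro bexI[of _ j]) auto
    next
      case False
      \<comment> \<open>No assignment makes a variable with a hole out of range true, so every
        position lies in the positive form; hole 1 serves as witness.\<close>
      then have "satisfies (occupied m g) C" for g
        using 2 unfolding satisfies_def
        by (intro exI[of _ "(i, j)"]) (auto simp add: mem_occupied)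
      then show ?thesis using f_in[of 1] \<open>m \<ge> 1\<close> unfolding pos_form_def
        by (intro bexI[of _ 1]) auto
    qed
  qed
next
  assume "\<exists>j\<in>{1..m}. (f j, j) \<in> pos_form m C"
  then show "satisfies (occupied m f) C"
    using f unfolding pos_form_def by auto
qed

section \<open>Restrictions, culprits and the existence of a wide clause\<close>

text \<open>A restriction places pigeon \<open>r j\<close> into hole \<open>j\<close> for each \<open>j \<in> D\<close>.\<close>

definition restriction :: "nat \<Rightarrow> nat set \<Rightarrow> (nat \<Rightarrow> nat) \<Rightarrow> bool" where
  "restriction m D r \<longleftrightarrow> D \<subseteq> {1..m} \<and> inj_on r D \<and> r ` D \<subseteq> {1..m+1}"

definition free_grid :: "nat \<Rightarrow> nat set \<Rightarrow> (nat \<Rightarrow> nat) \<Rightarrow> (nat \<times> nat) set" where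
  "free_grid m D r = ({1..m+1} - r ` D) \<times> ({1..m} - D)"

text \<open>If \<open>(r j, j)\<close> lies in the positive form, every critical assignment making
  that placement satisfies the clause. The first conjunct excludes such dead clauses.\<close>

definition live_wide ::
  "nat \<Rightarrow> nat set \<Rightarrow> (nat \<Rightarrow> nat) \<Rightarrow> real \<Rightarrow> (nat \<times> nat) clause \<Rightarrow> bool" where
  "live_wide m D r t C \<longleftrightarrow> (\<forall>j\<in>D. (r j, j) \<notin> pos_form m C) \<and>
     t \<le> real (card (pos_form m C \<inter> free_grid m D r))"

text \<open>This is the least set of pigeons whose pigeon clauses imply \<open>C\<close> on the
  critical assignments extending \<open>r\<close>. Its size is the complexity measure of the
  argument.\<close>

definition culprits ::
  "nat \<Rightarrow> nat set \<Rightarrow> (nat \<Rightarrow> nat) \<Rightarrow> (nat \<times> nat) clause \<Rightarrow> nat set" where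
  "culprits m D r C = {i \<in> {1..m+1}. \<exists>f. critical m f \<and> (\<forall>j\<in>D. f j = r j) \<and>
     i \<notin> f ` {1..m} \<and> \<not> satisfies (occupied m f) C}"

lemma finite_free_grid: "finite (free_grid m D r)"
  unfolding free_grid_def by simp

lemma finite_culprits: "finite (culprits m D r C)"
  unfolding culprits_def by simp

lemma card_free_pigeons:
  assumes "restriction m D r"
  shows "card ({1..m+1} - r ` D) = m + 1 - card D" "card ({1..m} - D) = m - card D"
    "card D \<le> m" "finite D"
proof -
  show "finite D" using assms finite_subset unfolding restriction_def by blast
  then show "card ({1..m+1} - r ` D) = m + 1 - card D" "card ({1..m} - D) = m - card D"
    using assms unfolding restriction_def by (simp_all add: card_Diff_subset card_image)
  show "card D \<le> m"
    using assms card_mono[of "{1..m}" D] unfolding restriction_def by simp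
qed

lemma culprits_subset:
  assumes "restriction m D r"
  shows "culprits m D r C \<subseteq> {1..m+1} - r ` D"
  using assms unfolding culprits_def restriction_def by (force simp: image_iff)

lemma culprits_empty:
  assumes r: "restriction m D r"
  shows "culprits m D r {||} = {1..m+1} - r ` D"
proof
  show "{1..m+1} - r ` D \<subseteq> culprits m D r {||}"
  proof
    fix i assume i: "i \<in> {1..m+1} - r ` D"
    let ?H = "{1..m} - D" and ?P = "{1..m+1} - r ` D - {i}"
    \<comment> \<open>There is one more free pigeon than free holes, so leaving out \<open>i\<close>
      balances the counts and the rest can be matched.\<close>
    have "card ?H = card ?P"
      using i card_free_pigeons[OF r] by simp
    then obtain h where h: "bij_betw h ?H ?P"
      using finite_same_card_bij[of ?H ?P] by auto
    let ?f = "\<lambda>j. if j \<in> D then r j else h j"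
    have hP: "h j \<in> ?P" if "j \<in> ?H" for j using h that bij_betwE by blast
    have "inj_on ?f {1..m}"
    proof (rule inj_onI)
      fix a b assume ab: "a \<in> {1..m}" "b \<in> {1..m}" "?f a = ?f b"
      have "inj_on r D" "inj_on h ?H"
        using r h unfolding restriction_def bij_betw_def by auto
      moreover have "r a \<noteq> h b" if "a \<in> D" "b \<in> ?H" for a b
        using hP[OF that(2)] imageI[OF that(1), of r] by auto
      moreover have "h a \<noteq> r b" if "b \<in> D" "a \<in> ?H" for a b
        using hP[OF that(2)] imageI[OF that(1), of r] by auto
      ultimately show "a = b"
        using ab by (auto split: if_splits dest: inj_onD)
    qed
    moreover have "?f ` {1..m} \<subseteq> {1..m+1} - {i}"
    proof
      fix k assume "k \<in> ?f ` {1..m}"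
      then obtain j where j: "j \<in> {1..m}" "k = ?f j" by blast
      show "k \<in> {1..m+1} - {i}"
      proof (cases "j \<in> D")
        case True
        then have "r j \<in> r ` D" by blast
        then show ?thesis using True j r i unfolding restriction_def by auto
      next
        case False
        then show ?thesis using j hP[of j] by auto
      qed
    qed
    ultimately have "critical m ?f" "i \<notin> ?f ` {1..m}"
      unfolding critical_def by blast+
    moreover have "\<forall>j\<in>D. ?f j = r j" by simp
    ultimately show "i \<in> culprits m D r {||}"
      using i not_satisfies_empty unfolding culprits_def by blast
  qed
qed (rule culprits_subset[OF r])

text \<open>An assignment falsifying \<open>C\<close> falsifies \<open>C1\<close> or
  \<open>C2\<close>. This makes the complexity measure subadditive.\<close>

lemma culprits_consequence:
  assumes "\<And>\<alpha>. satisfies \<alpha> C1 \<Longrightarrow> satisfies \<alpha> C2 \<Longrightarrow> satisfies \<alpha> C"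
  shows "culprits m D r C \<subseteq> culprits m D r C1 \<union> culprits m D r C2"
  using assms unfolding culprits_def by blast

text \<open>A pigeon clause is falsified only by leaving out its own pigeon; a hole clause is never
  falsified, as each hole holds one pigeon.\<close>

lemma card_culprits_php_clause:
  assumes "C \<in> php_clauses m"
  shows "card (culprits m D r C) \<le> 1"
proof -
  have "\<exists>i. culprits m D r C \<subseteq> {i}"
    using assms unfolding php_clauses_def
  proof (elim UnE CollectE exE conjE)
    fix i assume C: "C = fset_of_list (map (\<lambda>j. Pos (i, j)) [1..<m + 1])" and i: "i \<in> {1..m+1}"
    have "k = i" if k: "k \<in> culprits m D r C" for k
    proof -
      obtain f where f: "critical m f" "k \<in> {1..m+1}" "k \<notin> f ` {1..m}"
          "\<not> satisfies (occupied m f) C"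
        using k unfolding culprits_def by blast
      have "Pos (i, j) |\<in>| C" if "j \<in> {1..m}" for j
        using that by (auto simp: C fset_of_list_elem)
      then have "i \<noteq> f j" if "j \<in> {1..m}" for j
        using f(4) that mem_occupied[of i j m f] unfolding satisfies_def by blast
      then have "i \<notin> f ` {1..m}" by blast
      then show ?thesis using critical_missing[OF f(1-3)] i by auto
    qed
    then show ?thesis by blast
  next
    fix i i' j assume C: "C = {|Neg (i, j), Neg (i', j)|}" and "i < i'"
    then have "satisfies (occupied m f) C" for f
      unfolding satisfies_def by (cases "f j = i") (auto simp: mem_occupied)
    then show ?thesis unfolding culprits_def by blast
  qed
  then show ?thesis
    by (metis card_mono finite.emptyI finite.insertI is_singletonI is_singleton_altdef)
qed

text \<open>The first clause with more than a third of \<open>N\<close> culprits has two premises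
  with at most a third each, hence at most two thirds by subadditivity. The factor 3 avoids
  division.\<close>

lemma derivation_medium_culprits:
  assumes "derivation K Cs"
    and small: "\<And>C. C \<in> K \<Longrightarrow> 3 * card (culprits m D r C) \<le> N"
    and "C \<in> K \<union> set Cs" "3 * card (culprits m D r C) > N"
  shows "\<exists>C\<in>set Cs. N < 3 * card (culprits m D r C) \<and> 3 * card (culprits m D r C) \<le> 2 * N"
  using assms(1,3,4)
proof (induction arbitrary: C)
  case Nil
  then show ?case using small by fastforce
next
  case (Cons Cs C1 C2 B)
  let ?c = "\<lambda>C. card (culprits m D r C)"
  show ?case
  proof (cases "\<exists>C\<in>K \<union> set Cs. N < 3 * ?c C")
    case True
    then show ?thesis using Cons.IH by auto
  next
    case False
    then have le: "3 * ?c A \<le> N" if "A \<in> K \<union> set Cs" for A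
      using that by (meson not_less)
    have "C = B"
      using le[of C] Cons.prems by (auto simp: not_less[symmetric])
    moreover have "3 * ?c C1 \<le> N" "3 * ?c C2 \<le> N"
      using le Cons.hyps(2,3) by blast+
    moreover have "?c B \<le> ?c C1 + ?c C2"
      using culprits_consequence[OF Cons.hyps(4)]
      by (meson card_Un_le card_mono finite_UnI finite_culprits order_trans)
    ultimately show ?thesis using Cons.prems by auto
  qed
qed

text \<open>If leaving out \<open>i\<close> can falsify the clause but leaving out \<open>k\<close> cannot, then moving \<open>i\<close> into
  the hole of \<open>k\<close> makes the clause true, so that this position occurs in the positive form.\<close>

lemma card_pos_form_ge:
  assumes r: "restriction m D r" and "m \<ge> 1"
  shows "card (culprits m D r C) * (m + 1 - card D - card (culprits m D r C))
    \<le> card (pos_form m C \<inter> free_grid m D r)"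
proof -
  let ?W = "culprits m D r C" and ?P = "{1..m+1} - r ` D" and ?H = "{1..m} - D"
  let ?J = "\<lambda>i. {j \<in> ?H. (i, j) \<in> pos_form m C}"
  have row: "m + 1 - card D - card ?W \<le> card (?J i)" if i: "i \<in> ?W" for i
  proof -
    obtain f where f: "critical m f" "i \<in> {1..m+1}" "i \<notin> f ` {1..m}" "\<forall>j\<in>D. f j = r j"
        "\<not> satisfies (occupied m f) C"
      using i unfolding culprits_def by blast
    have "?P - ?W \<subseteq> f ` ?J i"
    proof
      fix k assume k: "k \<in> ?P - ?W"
      then have "k \<in> f ` {1..m}"
        using critical_missing[OF f(1-3)] i by auto
      then obtain j where j: "j \<in> {1..m}" "f j = k" by blast
      have jD: "j \<notin> D" using j k f(4) by auto
      let ?g = "f(j := i)"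
      have "critical m ?g"
        unfolding critical_def
      proof
        show "inj_on ?g {1..m}"
          using f(1,3) unfolding critical_def by (blast intro: inj_on_fun_updI)
        have "?g ` {1..m} \<subseteq> insert i (f ` {1..m})" by auto
        also have "\<dots> \<subseteq> {1..m+1}"
          using f(1,2) unfolding critical_def insert_subset by (intro conjI) simp_all
        finally show "?g ` {1..m} \<subseteq> {1..m+1}" .
      qed
      moreover have "k \<notin> ?g ` {1..m}"
      proof
        assume "k \<in> ?g ` {1..m}"
        then obtain l where "l \<in> {1..m}" "?g l = k" by blast
        then show False
          using f(1) j k i inj_onD[of f "{1..m}" l j] unfolding critical_def
          by (cases "l = j") auto
      qed
      moreover have "\<forall>j\<in>D. ?g j = r j" using f(4) jD by auto
      ultimately have "satisfies (occupied m ?g) C"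
        using k unfolding culprits_def by blast
      then obtain l where l: "l \<in> {1..m}" "(?g l, l) \<in> pos_form m C"
        using satisfies_iff_pos_form[OF \<open>critical m ?g\<close> \<open>m \<ge> 1\<close>] by blast
      \<comment> \<open>\<open>f\<close> and \<open>?g\<close> differ only at \<open>j\<close>, and
        \<open>f\<close> falsifies \<open>C\<close>, so the true position must be the moved
        one.\<close>
      have "l = j"
        using l f(5) satisfies_iff_pos_form[OF f(1) \<open>m \<ge> 1\<close>] by (auto split: if_splits)
      then have "j \<in> ?J i" using l j jD by auto
      then show "k \<in> f ` ?J i" using j by blast
    qed
    then have "card (?P - ?W) \<le> card (?J i)"
      by (rule surj_card_le[rotated]) simp
    moreover have "card (?P - ?W) = m + 1 - card D - card ?W"
      using card_free_pigeons[OF r] culprits_subset[OF r] finite_culprits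
      by (simp add: card_Diff_subset)
    ultimately show ?thesis by simp
  qed
  have "card ?W * (m + 1 - card D - card ?W) = (\<Sum>i\<in>?W. m + 1 - card D - card ?W)" by simp
  also have "\<dots> \<le> (\<Sum>i\<in>?W. card (?J i))" using row by (rule sum_mono)
  also have "\<dots> = card (Sigma ?W ?J)" using finite_culprits by simp
  also have "\<dots> \<le> card (pos_form m C \<inter> free_grid m D r)"
    using culprits_subset[OF r, of C] finite_free_grid
    by (intro card_mono) (auto simp: free_grid_def)
  finally show ?thesis .
qed

text \<open>All free pigeons are culprits of the empty clause and at most one is a culprit of an
  axiom, so a clause of medium complexity occurs; its positive form is wide by
  \<open>card_pos_form_ge\<close>.\<close>

lemma derivation_live_wide:
  assumes d: "derivation (php_clauses m) Cs" and empty: "{||} \<in> php_clauses m \<union> set Cs"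
    and r: "restriction m D r" and n: "card D + 2 \<le> m"
  shows "\<exists>C\<in>set Cs. live_wide m D r ((real (m + 1 - card D))\<^sup>2 / 9) C"
proof -
  define N where "N = m + 1 - card D"
  have "3 * card (culprits m D r C) \<le> N" if "C \<in> php_clauses m" for C
    \<comment> \<open>At least three pigeons are free, so one culprit is at most a third.\<close>
    using card_culprits_php_clause[OF that, of D r] n unfolding N_def by linarith
  moreover have "3 * card (culprits m D r {||}) > N"
    using culprits_empty[OF r] card_free_pigeons[OF r] n unfolding N_def by simp
  ultimately obtain C where C: "C \<in> set Cs" "N < 3 * card (culprits m D r C)"
      "3 * card (culprits m D r C) \<le> 2 * N"
    using derivation_medium_culprits[OF d _ empty] by blast
  define c where "c = card (culprits m D r C)"
  have le: "N \<le> 3 * c" "N \<le> 3 * (N - c)" using C unfolding c_def by linarith+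
  have "N * N \<le> (3 * c) * (3 * (N - c))" using le by (rule mult_le_mono)
  also have "\<dots> = 9 * (c * (N - c))" by simp
  also have "\<dots> \<le> 9 * card (pos_form m C \<inter> free_grid m D r)"
    using card_pos_form_ge[OF r, of C] n unfolding c_def N_def by simp
  finally have "real N * real N \<le> 9 * real (card (pos_form m C \<inter> free_grid m D r))"
    by (metis of_nat_le_iff of_nat_mult of_nat_numeral)
  \<comment> \<open>The clause is live: a culprit yields an extension of \<open>r\<close> that
    falsifies it.\<close>
  moreover have "(r j, j) \<notin> pos_form m C" if "j \<in> D" for j
  proof -
    have "culprits m D r C \<noteq> {}" using C(2) by auto
    then obtain f where f: "critical m f" "\<forall>j\<in>D. f j = r j" "\<not> satisfies (occupied m f) C"
      unfolding culprits_def by blast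
    have "j \<in> {1..m}" using that r unfolding restriction_def by blast
    then have "(f j, j) \<notin> pos_form m C"
      using satisfies_iff_pos_form[OF f(1), of C] f(3) n by simp
    then show ?thesis using f(2) that by simp
  qed
  ultimately show ?thesis
    using C(1) unfolding live_wide_def N_def[symmetric]
    by (intro bexI[of _ C]) (auto simp: power2_eq_square)
qed

section \<open>Greedy restrictions by double counting\<close>

text \<open>Averaging over \<open>G\<close>: the pairs of \<open>C \<in> B\<close> and
  \<open>x \<in> M C \<inter> G\<close> number at least \<open>t * card B\<close>, so some
  \<open>x\<close> has at least the mean share.\<close>

lemma exists_popular_position:
  assumes "finite B" "finite G" "G \<noteq> {}"
    and wide: "\<And>C. C \<in> B \<Longrightarrow> t \<le> real (card (M C \<inter> G))"
  shows "\<exists>x\<in>G. t * real (card B) \<le> real (card G) * real (card {C \<in> B. x \<in> M C})"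
proof (rule ccontr)
  assume "\<not> ?thesis"
  then have less: "real (card G) * real (card {C \<in> B. x \<in> M C}) < t * real (card B)"
    if "x \<in> G" for x using that by force
  have "real (card G) * (t * real (card B)) \<le> real (card G) * (\<Sum>C\<in>B. real (card (M C \<inter> G)))"
    using sum_mono[of B "\<lambda>_. t" "\<lambda>C. real (card (M C \<inter> G))"] wide
    by (intro mult_left_mono) (simp_all add: mult.commute)
  also have "(\<Sum>C\<in>B. real (card (M C \<inter> G))) = (\<Sum>C\<in>B. \<Sum>x\<in>G. if x \<in> M C then 1 else 0)"
    using assms(2) by (intro sum.cong) (simp_all add: sum.If_cases Int_commute Int_def)
  also have "\<dots> = (\<Sum>x\<in>G. \<Sum>C\<in>B. if x \<in> M C then 1 else 0)"
    by (rule sum.swap)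
  also have "\<dots> = (\<Sum>x\<in>G. real (card {C \<in> B. x \<in> M C}))"
    using assms(1) by (intro sum.cong) (simp_all add: sum.If_cases Int_def)
  also have "real (card G) * \<dots> = (\<Sum>x\<in>G. real (card G) * real (card {C \<in> B. x \<in> M C}))"
    by (rule sum_distrib_left)
  also have "\<dots> < (\<Sum>x\<in>G. t * real (card B))"
    using assms(2,3) less by (intro sum_strict_mono) auto
  finally show False by simp
qed

text \<open>Each placement uses a position common to at least a fraction \<open>q\<close> of the
  live wide clauses and thereby kills them.\<close>

lemma exists_restriction:
  assumes S: "finite S" and "m \<ge> 1" and k: "k \<le> m" and q: "0 \<le> q" "q \<le> 1"
  shows "\<exists>D r. restriction m D r \<and> card D = k \<and>
    real (card {C \<in> S. live_wide m D r (q * real (m * (m + 1))) C}) \<le> real (card S) * (1 - q) ^ k"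
  using k
proof (induction k)
  case 0
  have "card {C \<in> S. live_wide m {} (\<lambda>a. a) (q * real (m * (m + 1))) C} \<le> card S"
    using S by (intro card_mono) auto
  then show ?case
    by (intro exI[of _ "{}"] exI[of _ "\<lambda>a. a"]) (simp add: restriction_def)
next
  case (Suc k)
  let ?t = "q * real (m * (m + 1))"
  let ?B = "\<lambda>D r. {C \<in> S. live_wide m D r ?t C}"
  obtain D r where r: "restriction m D r" "card D = k"
      and IH: "real (card (?B D r)) \<le> real (card S) * (1 - q) ^ k"
    using Suc by auto
  let ?G = "free_grid m D r"
  have fin: "finite (?B D r)" using S by simp
  have cardG: "card ?G = (m + 1 - k) * (m - k)"
    using card_free_pigeons[OF r(1)] r(2) unfolding free_grid_def by (simp add: card_cartesian_product)
  have "?G \<noteq> {}"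
    using cardG Suc.prems by fastforce
  moreover have "?t \<le> real (card (pos_form m C \<inter> ?G))" if "C \<in> ?B D r" for C
    using that unfolding live_wide_def by simp
  ultimately obtain x where x: "x \<in> ?G"
      "?t * real (card (?B D r)) \<le> real (card ?G) * real (card {C \<in> ?B D r. x \<in> pos_form m C})"
    using exists_popular_position[OF fin finite_free_grid] by blast
  let ?X = "{C \<in> ?B D r. x \<in> pos_form m C}"
  obtain i j where ij: "x = (i, j)" by fastforce
  \<comment> \<open>The free grid shrinks while the threshold stays fixed, so the popular share is
    at least \<open>q\<close> in every round.\<close>
  have "card ?G \<le> m * (m + 1)"
    unfolding cardG by (subst mult.commute) (intro mult_le_mono; simp)
  then have "real (card ?G) * real (card ?X) \<le> real (m * (m + 1)) * real (card ?X)"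
    by (intro mult_right_mono) (simp_all only: of_nat_le_iff of_nat_0_le_iff)
  with x(2) have "real (m * (m + 1)) * (q * real (card (?B D r))) \<le> real (m * (m + 1)) * real (card ?X)"
    by (simp add: mult_ac)
  moreover have "0 < real (m * (m + 1))" using \<open>m \<ge> 1\<close> unfolding of_nat_0_less_iff by simp
  ultimately have pop: "q * real (card (?B D r)) \<le> real (card ?X)"
    by (simp only: mult_le_cancel_left_pos)
  let ?D = "insert j D" and ?r = "r(j := i)"
  have new: "i \<in> {1..m+1}" "i \<notin> r ` D" "j \<in> {1..m}" "j \<notin> D"
    using x(1) unfolding ij free_grid_def by auto
  have rD: "?r ` ?D = insert i (r ` D)" using new(4) by (auto simp: image_iff)
  have restr: "restriction m ?D ?r"
    using r(1) new unfolding restriction_def rD by (auto simp: inj_on_def)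
  have "free_grid m ?D ?r \<subseteq> ?G"
    unfolding free_grid_def rD by auto
  then have sub: "card (pos_form m C \<inter> free_grid m ?D ?r) \<le> card (pos_form m C \<inter> ?G)" for C
    by (intro card_mono) (auto simp: finite_free_grid)
  \<comment> \<open>Extending the restriction revives no clause and widens none, and it kills those
    containing \<open>x\<close>.\<close>
  have "?B ?D ?r \<subseteq> ?B D r - ?X"
  proof
    fix C assume C: "C \<in> ?B ?D ?r"
    then have "(?r l, l) \<notin> pos_form m C" if "l \<in> ?D" for l
      using that unfolding live_wide_def by blast
    from this[of j] this[OF insertI2] have "x \<notin> pos_form m C" "\<forall>l\<in>D. (r l, l) \<notin> pos_form m C"
      using new(4) ij by (simp, metis fun_upd_other)
    moreover have "?t \<le> real (card (pos_form m C \<inter> ?G))"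
      using C sub[of C] unfolding live_wide_def by simp
    ultimately show "C \<in> ?B D r - ?X" using C unfolding live_wide_def by blast
  qed
  then have "card (?B ?D ?r) \<le> card (?B D r - ?X)"
    using fin by (intro card_mono) auto
  also have "\<dots> = card (?B D r) - card ?X"
    using S by (intro card_Diff_subset) auto
  finally have "real (card (?B ?D ?r)) \<le> real (card (?B D r)) - real (card ?X)"
    using card_mono[OF fin, of ?X] by fastforce
  also have "\<dots> \<le> (1 - q) * real (card (?B D r))"
    using pop by (simp add: algebra_simps)
  also have "\<dots> \<le> (1 - q) * (real (card S) * (1 - q) ^ k)"
    using IH q by (intro mult_left_mono) auto
  also have "\<dots> = real (card S) * (1 - q) ^ Suc k" by simp
  finally have "real (card (?B ?D ?r)) \<le> real (card S) * (1 - q) ^ Suc k" .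
  moreover have "card ?D = Suc k"
    using card_free_pigeons(4)[OF r(1)] r(2) new(4) by simp
  ultimately show ?case using restr by blast
qed

section \<open>The exponential bound against polynomial growth\<close>

text \<open>After \<open>k\<close> greedy placements a live wide clause must remain, so at least one
  of the clauses survives the shrinking by \<open>(35/36) ^ k\<close>. The condition
  \<open>k \<ge> 2\<close> leaves at least three free pigeons.\<close>

lemma php_derivation_length:
  assumes d: "derivation (php_clauses (2 * k)) Cs" and empty: "{||} \<in> php_clauses (2 * k) \<union> set Cs"
    and "k \<ge> 2"
  shows "1 \<le> real (length Cs) * (35 / 36) ^ k"
proof -
  let ?m = "2 * k" and ?t = "1 / 36 * real (2 * k * (2 * k + 1))"
  obtain D r where r: "restriction ?m D r" "card D = k"
    and few: "real (card {C \<in> set Cs. live_wide ?m D r ?t C}) \<le> real (card (set Cs)) * (1 - 1/36) ^ k"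
    using exists_restriction[of "set Cs" ?m k "1/36"] \<open>k \<ge> 2\<close> by auto
  obtain C where "C \<in> set Cs" and C: "live_wide ?m D r ((real (?m + 1 - card D))\<^sup>2 / 9) C"
    using derivation_live_wide[OF d empty r(1)] r(2) \<open>k \<ge> 2\<close> by auto
  \<comment> \<open>The constant 1/36 fits because \<open>k + 1\<close> pigeons stay free and
    \<open>2 * k * (2 * k + 1) \<le> 4 * (k + 1)^2\<close>.\<close>
  moreover have "?t \<le> (real (?m + 1 - card D))\<^sup>2 / 9"
    by (simp add: r(2) power2_eq_square algebra_simps)
  ultimately have "C \<in> {C \<in> set Cs. live_wide ?m D r ?t C}"
    unfolding live_wide_def by auto
  then have "0 < card {C \<in> set Cs. live_wide ?m D r ?t C}"
    by (subst card_gt_0_iff) auto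
  then have "1 \<le> real (card (set Cs)) * (35 / 36) ^ k"
    using few by simp
  also have "\<dots> \<le> real (length Cs) * (35 / 36) ^ k"
    by (intro mult_right_mono) (simp_all add: card_length)
  finally show ?thesis .
qed

text \<open>Writing \<open>c ^ k\<close> as \<open>s ^ k * s ^ k\<close> with
  \<open>s = sqrt c\<close>, one factor absorbs the linear term and the other goes to the induction
  hypothesis, hence \<open>c\<close> is arbitrary. The argument \<open>2 * real k\<close> is the
  number of holes.\<close>

lemma poly_times_power_tendsto_0:
  fixes p :: "real poly"
  assumes "0 \<le> c" "c < 1"
  shows "(\<lambda>k. poly p (2 * real k) * c ^ k) \<longlonglongrightarrow> 0"
  using assms
proof (induction p arbitrary: c)
  case 0
  then show ?case by simp
next
  case (pCons a p)
  define s where "s = sqrt c"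
  have s: "0 \<le> s" "s < 1" "c = s * s" using pCons.prems unfolding s_def by simp_all
  have "(\<lambda>k. a * c ^ k + 2 * (real k * s ^ k) * (poly p (2 * real k) * s ^ k)) \<longlonglongrightarrow> a * 0 + 2 * 0 * 0"
  proof (rule tendsto_add)
    show "(\<lambda>k. a * c ^ k) \<longlonglongrightarrow> a * 0"
      using pCons.prems by (intro tendsto_mult_left LIMSEQ_realpow_zero)
    have "(\<lambda>k. real k * s ^ k) \<longlonglongrightarrow> 0"
      using s by (intro powser_times_n_limit_0) simp
    then show "(\<lambda>k. 2 * (real k * s ^ k) * (poly p (2 * real k) * s ^ k)) \<longlonglongrightarrow> 2 * 0 * 0"
      using pCons.IH[OF s(1,2)] by (intro tendsto_mult tendsto_const)
  qed
  moreover have "poly (pCons a p) (2 * real k) * c ^ k =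
      a * c ^ k + 2 * (real k * s ^ k) * (poly p (2 * real k) * s ^ k)" for k
    unfolding s(3) by (simp add: power_mult_distrib algebra_simps)
  ultimately show ?case by simp
qed

lemma covers_PHP: "covers (php_clauses m) (PHP m)"
  unfolding covers_def PHP_def by (auto simp: finite_php_clauses)

theorem theorem11:
  "\<not> (\<exists>(\<pi> :: nat \<Rightarrow> (nat \<times> nat) formula list) (p :: real poly).
        \<forall>m \<ge> 1. ressv_proof (PHP m) (\<pi> m) {#({||}, \<infinity>)#} \<and>
               real (proof_length (\<pi> m)) \<le> poly p (real m))"
proof
  assume "\<exists>(\<pi> :: nat \<Rightarrow> (nat \<times> nat) formula list) (p :: real poly).
        \<forall>m \<ge> 1. ressv_proof (PHP m) (\<pi> m) {#({||}, \<infinity>)#} \<and>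
               real (proof_length (\<pi> m)) \<le> poly p (real m)"
  then obtain \<pi> :: "nat \<Rightarrow> (nat \<times> nat) formula list" and p :: "real poly"
    where \<pi>: "\<And>m. m \<ge> 1 \<Longrightarrow> ressv_proof (PHP m) (\<pi> m) {#({||}, \<infinity>)#}"
      and p: "\<And>m. m \<ge> 1 \<Longrightarrow> real (proof_length (\<pi> m)) \<le> poly p (real m)"
    by blast
  have ge: "1 \<le> poly p (2 * real k) * (35 / 36) ^ k" if "k \<ge> 2" for k
  proof -
    have m: "2 * k \<ge> 1" using that by simp
    obtain Cs where Cs: "derivation (php_clauses (2 * k)) Cs"
        "length Cs \<le> proof_length (\<pi> (2 * k))" "{||} \<in> php_clauses (2 * k) \<union> set Cs"
      using ressv_proof_derivation[OF \<pi>[OF m] covers_PHP] .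
    have "1 \<le> real (length Cs) * (35 / 36) ^ k"
      using php_derivation_length[OF Cs(1,3) that] .
    also have "\<dots> \<le> poly p (2 * real k) * (35 / 36) ^ k"
      using Cs(2) p[OF m] by (intro mult_right_mono) simp_all
    finally show ?thesis .
  qed
  \<comment> \<open>The sequence is at least 1 from \<open>k = 2\<close> on, yet it tends to
    0.\<close>
  have "(\<lambda>k. poly p (2 * real k) * (35 / 36) ^ k) \<longlonglongrightarrow> 0"
    by (rule poly_times_power_tendsto_0) simp_all
  then have "1 \<le> (0::real)"
    by (rule LIMSEQ_le_const) (use ge in blast)
  then show False by simp
qed

end
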